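(* For similar hyperbolic $A,B\in\mathrm{GL}(n,\mathbb{Z})$, the following are equivalent: (a) $A$ is conjugate to $B$; (b) there exists a topological $R$-module isomorphism $\Psi:G_A\to G_B$ such that $\Psi\big(\iota_A(\mathbb{Z}^n)\big)=\iota_B(\mathbb{Z}^n)$; (c) there exists a topological $R$-module isomorphism $\Psi:G_A\to G_B$ such that $\Psi\big(\iota_A(\mathbb{Z}^n)\big)\cap\iota_B(\mathbb{Z}^n)$ is $R$-module isomorphic to the right $\mathbb{Z}[B]$-module $\mathbb{Z}^n$.
   Context: A matrix in $\mathrm{GL}(n,\mathbb{Z})$ is hyperbolic if it has no eigenvalue of modulus $1$. Matrices $A,B\in\mathrm{GL}(n,\mathbb{Z})$ are similar if there is $C\in\mathrm{GL}(n,\mathbb{Q})$ with $AC=CB$, and conjugate if there is $C\in\mathrm{GL}(n,\mathbb{Z})$ with $AC=CB$. For similar $A,B$, a polynomial $q\in\mathbb{Z}[x]$ satisfies $q(A)=0$ if and only if $q(B)=0$; let $R=\mathbb{Z}[x]/\{q\in\mathbb{Z}[x]: q(A)=0\}$, so that $R\cong\mathbb{Z}[A]\cong\mathbb{Z}[B]$ as rings via $x\mapsto A$ and $x\mapsto B$ (when the common characteristic polynomial $p(x)$ is irreducible, $R=\mathbb{Z}[x]/(p(x))$). Regard $\mathbb{Z}^n$ as row vectors. The right $\mathbb{Z}[B]$-module $\mathbb{Z}^n$ is $\mathbb{Z}^n$ with $B$ acting by $m\mapsto mB$; it is an $R$-module with $x$ acting through $B$. Similarly for $A$. For $k\in\mathbb{N}=\{1,2,\dots\}$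 set $N_{k,A}=\mathbb{Z}^n(A^{k!}-I)$ and $G_{k,A}=\mathbb{Z}^n/N_{k,A}$, a finite group with elements $[m]_{k,A}=m+N_{k,A}$, given the discrete topology and the $R$-module structure in which $x$ acts by $[m]_{k,A}\mapsto[mA]_{k,A}$. For $l\le k$ one has $N_{k,A}\le N_{l,A}$, and there is the canonical epimorphism $\varphi_{k,l,A}:G_{k,A}\to G_{l,A}$, $[m]_{k,A}\mapsto[m]_{l,A}$. The profinite $R$-module $G_A$ is the inverse limit $\varprojlim_{k\in\mathbb{N}}G_{k,A}\le\prod_{k\in\mathbb{N}}G_{k,A}$ of this inverse system, with the topology induced by the product topology, and with $x$ acting by $\Gamma_A(\{[m_k]_{k,A}\}_{k})=\{[m_kA]_{k,A}\}_{k}$. The canonical homomorphism $\iota_A:\mathbb{Z}^n\to G_A$ is $\iota_A(m)=\{[m]_{k,A}\}_{k\in\mathbb{N}}$. The module $G_B$ and the map $\iota_B$ are defined in the same way from $B$, with $x$ acting through $B$. A topological $R$-module isomorphism is an $R$-module isomorphism that is also a homeomorphism. *)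

theory Defs
  imports
    "HOL-Analysis.Analysis"
    "HOL-Computational_Algebra.Polynomial"
    "HOL-Algebra.Module"
    "HOL-Algebra.QuotRing"
    "HOL-Algebra.Algebraic_Closure_Type"
begin

section \<open>Integer matrices\<close>

text \<open>
  An element of GL(n,Z) is a matrix \<open>A :: int ^ 'n ^ 'n\<close> with \<open>invertible A\<close>: the library
  predicate asks for a two-sided inverse with entries in the same ring, here the integers.
\<close>

definition hyperbolic :: "int ^ 'n ^ 'n \<Rightarrow> bool" where
  "hyperbolic A \<longleftrightarrow>
     \<not> (\<exists>(z :: complex) (v :: complex ^ 'n).
           v \<noteq> 0 \<and> map_matrix of_int A *v v = z *s v \<and> cmod z = 1)"

definition similar_matrices :: "int ^ 'n ^ 'n \<Rightarrow> int ^ 'n ^ 'n \<Rightarrow> bool" where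
  "similar_matrices A B \<longleftrightarrow>
     (\<exists>C :: rat ^ 'n ^ 'n. invertible C \<and> map_matrix of_int A ** C = C ** map_matrix of_int B)"

definition conjugate_matrices :: "int ^ 'n ^ 'n \<Rightarrow> int ^ 'n ^ 'n \<Rightarrow> bool" where
  "conjugate_matrices A B \<longleftrightarrow> (\<exists>C :: int ^ 'n ^ 'n. invertible C \<and> A ** C = C ** B)"

text \<open>The class operations \<open>*\<close> and \<open>^\<close> act componentwise on vectors, hence this definition.\<close>

definition matrix_power :: "int ^ 'n ^ 'n \<Rightarrow> nat \<Rightarrow> int ^ 'n ^ 'n" where
  "matrix_power A k = (((**) A) ^^ k) (mat 1)"

definition poly_matrix :: "int poly \<Rightarrow> int ^ 'n ^ 'n \<Rightarrow> int ^ 'n ^ 'n" where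
  "poly_matrix q A = (\<Sum>i\<le>Polynomial.degree q. mat (Polynomial.coeff q i) ** matrix_power A i)"


section \<open>The ring R and R-modules\<close>

text \<open>
  The quotient of Z[x] by the ideal of polynomials that annihilate the matrix. Its elements are
  the residue classes, i.e. sets of polynomials.
\<close>

definition poly_quot_ring :: "int ^ 'n ^ 'n \<Rightarrow> int poly set ring" where
  "poly_quot_ring A = ring_of_type_algebra Quot {q. poly_matrix q A = 0}"

text \<open>
  A module is a record extending a ring record, but the predicate \<open>module\<close> only concerns its
  additive group and its scalar multiplication. The fields \<open>mult\<close> and \<open>one\<close> are
  irrelevant and left \<open>undefined\<close>.

  The row vectors, with a residue class of polynomials acting through any of its members q by
  m \<open>\<mapsto>\<close> m q(B). This makes sense over \<open>poly_quot_ring A\<close> whenever A and B are annihilated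
  by the same polynomials, in particular for similar A and B.
\<close>

definition row_module :: "int ^ 'n ^ 'n \<Rightarrow> (int poly set, int ^ 'n) module" where
  "row_module B =
     \<lparr>carrier = UNIV, mult = undefined, one = undefined, zero = 0, add = (+),
      smult = (\<lambda>r m. the_elem ((\<lambda>q. m v* poly_matrix q B) ` r))\<rparr>"

text \<open>The scalar multiplication is r(m + N) = rm + N, in the style of \<^const>\<open>rcoset_mult\<close>.\<close>

definition quot_module :: "('r, 'a) module \<Rightarrow> 'a set \<Rightarrow> ('r, 'a set) module" where
  "quot_module M N =
     \<lparr>carrier = a_rcosets\<^bsub>M\<^esub> N, mult = undefined, one = undefined, zero = N, add = set_add M,
      smult = (\<lambda>r S. \<Union>m\<in>S. N +>\<^bsub>M\<^esub> (r \<odot>\<^bsub>M\<^esub> m))\<rparr>"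

definition module_iso ::
    "('r, 'c) ring_scheme \<Rightarrow> ('r, 'a) module \<Rightarrow> ('r, 'b) module \<Rightarrow> ('a \<Rightarrow> 'b) set" where
  "module_iso R M N =
     {f. f \<in> iso (add_monoid M) (add_monoid N) \<and>
         (\<forall>r\<in>carrier R. \<forall>x\<in>carrier M. f (r \<odot>\<^bsub>M\<^esub> x) = r \<odot>\<^bsub>N\<^esub> f x)}"


section \<open>The profinite module of a matrix\<close>

definition pro_subgroup :: "int ^ 'n ^ 'n \<Rightarrow> nat \<Rightarrow> (int ^ 'n) set" where
  "pro_subgroup A k = range (\<lambda>m. m v* (matrix_power A (fact k) - mat 1))"

definition pro_quot :: "int ^ 'n ^ 'n \<Rightarrow> nat \<Rightarrow> (int poly set, (int ^ 'n) set) module" where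
  "pro_quot A k = quot_module (row_module A) (pro_subgroup A k)"

definition pro_class :: "int ^ 'n ^ 'n \<Rightarrow> nat \<Rightarrow> int ^ 'n \<Rightarrow> (int ^ 'n) set" where
  "pro_class A k m = pro_subgroup A k +>\<^bsub>row_module A\<^esub> m"

text \<open>
  The canonical epimorphism from level k to level \<open>l \<le> k\<close>, sending the class of m to the class
  of m. The value does not depend on k, which is therefore not an argument.
\<close>

definition pro_map :: "int ^ 'n ^ 'n \<Rightarrow> nat \<Rightarrow> (int ^ 'n) set \<Rightarrow> (int ^ 'n) set" where
  "pro_map A l S = (\<Union>m\<in>S. pro_class A l m)"

text \<open>Families are indexed by the positive integers and extensional outside of them.\<close>

definition profinite_module ::
    "int ^ 'n ^ 'n \<Rightarrow> (int poly set, nat \<Rightarrow> (int ^ 'n) set) module" where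
  "profinite_module A =
     \<lparr>carrier = {g \<in> \<Pi>\<^sub>E k\<in>{1..}. carrier (pro_quot A k).
                   \<forall>k l. 1 \<le> l \<and> l \<le> k \<longrightarrow> pro_map A l (g k) = g l},
      mult = undefined, one = undefined,
      zero = (\<lambda>k\<in>{1..}. \<zero>\<^bsub>pro_quot A k\<^esub>),
      add = (\<lambda>g h. \<lambda>k\<in>{1..}. g k \<oplus>\<^bsub>pro_quot A k\<^esub> h k),
      smult = (\<lambda>r g. \<lambda>k\<in>{1..}. r \<odot>\<^bsub>pro_quot A k\<^esub> g k)\<rparr>"

definition profinite_topology :: "int ^ 'n ^ 'n \<Rightarrow> (nat \<Rightarrow> (int ^ 'n) set) topology" where
  "profinite_topology A =
     subtopology
       (product_topology (\<lambda>k. discrete_topology (carrier (pro_quot A k))) {1..})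
       (carrier (profinite_module A))"

definition profinite_embedding :: "int ^ 'n ^ 'n \<Rightarrow> int ^ 'n \<Rightarrow> nat \<Rightarrow> (int ^ 'n) set" where
  "profinite_embedding A m = (\<lambda>k\<in>{1..}. pro_class A k m)"

text \<open>For similar A and B the ring \<open>poly_quot_ring A\<close> is also the ring of B.\<close>

definition profinite_iso ::
    "int ^ 'n ^ 'n \<Rightarrow> int ^ 'n ^ 'n \<Rightarrow> ((nat \<Rightarrow> (int ^ 'n) set) \<Rightarrow> nat \<Rightarrow> (int ^ 'n) set) \<Rightarrow> bool" where
  "profinite_iso A B \<Psi> \<longleftrightarrow>
     \<Psi> \<in> module_iso (poly_quot_ring A) (profinite_module A) (profinite_module B) \<and>
     homeomorphic_map (profinite_topology A) (profinite_topology B) \<Psi>"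

end

theory Submission
  imports Defs
begin

no_notation fps_nth (infixl "$" 75)

text \<open>
  Write \<open>N\<^sub>k\<close> for \<open>pro_subgroup A k\<close> and \<open>L\<^sub>A\<close> for the image of the lattice of row vectors in
  the profinite module of \<open>A\<close>.

  A conjugating matrix \<open>C\<close> acts on row vectors by an isomorphism that intertwines \<open>A\<close> and \<open>B\<close>,
  hence maps the subgroups \<open>N\<^sub>k\<close> of \<open>A\<close> onto those of \<open>B\<close> and induces a topological module
  isomorphism that carries \<open>L\<^sub>A\<close> to \<open>L\<^sub>B\<close> (\<open>profinite_iso_induced_map\<close>). If an isomorphism carries
  \<open>L\<^sub>A\<close> to \<open>L\<^sub>B\<close>, the intersection in the third condition is \<open>L\<^sub>B\<close>, which is a copy of the row
  module because the lattice embeds (\<open>inj_profinite_embedding\<close>).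

  The substance is the way back from the third condition. There \<open>\<Psi>\<close> maps a subgroup of \<open>L\<^sub>A\<close>
  onto a group isomorphic to the whole lattice, and a subgroup of the lattice of full rank contains
  all multiples of some \<open>d > 0\<close>. So for every lattice vector \<open>m\<close>, the \<open>d\<close>-fold multiple of
  \<open>\<Psi> m\<close> lies in \<open>L\<^sub>B\<close>. But the quotient of the profinite module by \<open>L\<^sub>B\<close> has no torsion
  (\<open>pro_point_multiple_in_lattice\<close>), hence \<open>\<Psi> m\<close> itself lies in \<open>L\<^sub>B\<close>. The intersection is
  therefore all of \<open>\<Psi> L\<^sub>A\<close>, and the row modules of \<open>A\<close> and \<open>B\<close> are isomorphic. An additive
  bijection of the lattice is an invertible integer matrix, and commuting with the actions makes
  it a conjugation.

  The quotient has no torsion because the \<open>N\<^sub>k\<close> and the subgroups of multiples of a positive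
  integer are cofinal in each other, so that the profinite module is the profinite completion of
  the lattice. Powers of an invertible matrix are periodic modulo \<open>d\<close>, so \<open>N\<^sub>k\<close> consists of
  multiples of \<open>d\<close> for large \<open>k\<close> (\<open>pro_subgroup_subset_multiples\<close>). Conversely a power of a
  hyperbolic matrix minus the identity is nonsingular, so each \<open>N\<^sub>k\<close> has finite index
  (\<open>multiples_subset_pro_subgroup\<close>).
\<close>

section \<open>Integer matrices acting on row vectors\<close>

lemma mat_matrix_mult: "mat c ** M = (\<chi> i j. c * M $ i $ j)"
  for M :: "'a::semiring_1 ^ 'n ^ 'm"
  by (simp add: vec_eq_iff matrix_matrix_mult_def mat_def if_distrib if_distribR sum.delta
      cong: if_cong)

lemma matrix_mult_mat: "M ** mat c = mat c ** M"
  for M :: "'a::comm_semiring_1 ^ 'n ^ 'm"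
  unfolding mat_matrix_mult
  by (simp add: vec_eq_iff matrix_matrix_mult_def mat_def if_distrib if_distribR sum.delta
      mult.commute cong: if_cong)

lemma vector_matrix_mult_mat: "v v* (mat c ** M) = c *s (v v* M)"
  for M :: "'a::comm_semiring_1 ^ 'n ^ 'm"
  unfolding mat_matrix_mult
  by (simp add: vec_eq_iff vector_matrix_mult_def sum_distrib_left algebra_simps)

lemma matrix_add_rdistrib: "(P + Q) ** M = P ** M + Q ** M"
  for M :: "'a::semiring_1 ^ 'n ^ 'm"
  by (simp add: vec_eq_iff matrix_matrix_mult_def sum.distrib distrib_right)

lemma matrix_mult_sum_left: "(\<Sum>i\<in>I. F i) ** M = (\<Sum>i\<in>I. F i ** M)"
  for M :: "'a::semiring_1 ^ 'n ^ 'm"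
  by (induction I rule: infinite_finite_induct)
     (simp_all add: matrix_add_rdistrib)

lemma matrix_mult_sum_right: "M ** (\<Sum>i\<in>I. F i) = (\<Sum>i\<in>I. M ** F i)"
  for M :: "'a::semiring_1 ^ 'n ^ 'm"
  by (induction I rule: infinite_finite_induct)
     (simp_all add: matrix_add_ldistrib)

lemma map_matrix_of_int_mult:
  fixes P Q :: "int ^ 'n ^ 'n"
  shows "map_matrix of_int (P ** Q) =
    (map_matrix of_int P ** map_matrix of_int Q :: 'a::ring_1 ^ 'n ^ 'n)"
  by (simp add: vec_eq_iff matrix_matrix_mult_def)

lemma map_matrix_of_int_mat [simp]:
  "map_matrix of_int (mat c) = (mat (of_int c) :: 'a::ring_1 ^ 'n ^ 'n)"
  by (simp add: vec_eq_iff mat_def)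

lemma map_matrix_of_int_diff:
  fixes P Q :: "int ^ 'n ^ 'n"
  shows "map_matrix of_int (P - Q) =
    (map_matrix of_int P - map_matrix of_int Q :: 'a::ring_1 ^ 'n ^ 'n)"
  by (simp add: vec_eq_iff)

lemma map_matrix_of_int_sum:
  fixes F :: "'i \<Rightarrow> int ^ 'n ^ 'n"
  shows "map_matrix of_int (\<Sum>i\<in>I. F i) =
    (\<Sum>i\<in>I. map_matrix of_int (F i) :: 'a::ring_1 ^ 'n ^ 'n)"
  by (simp add: vec_eq_iff)

lemma map_matrix_id [simp]: "map_matrix id P = P"
  by (simp add: vec_eq_iff)

lemma additive_sum:
  assumes "\<And>x y :: 'a::ab_group_add. f (x + y) = (f x + f y :: 'b::ab_group_add)"
  shows "f (\<Sum>i\<in>I. g i) = (\<Sum>i\<in>I. f (g i))"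
proof -
  have "f 0 = 0" using assms[of 0 0] by simp
  then show ?thesis
    by (induction I rule: infinite_finite_induct) (simp_all add: assms)
qed

lemma additive_int_scale:
  assumes "\<And>x y :: int ^ 'n. f (x + y) = (f x + f y :: int ^ 'm)"
  shows "f (c *s x) = c *s f x"
proof -
  have f0: "f 0 = 0" using assms[of 0 0] by simp
  have pos: "f (int n *s x) = int n *s f x" for n x
    by (induction n) (simp_all add: f0 assms vector_sadd_rdistrib)
  have neg: "f (- x) = - f x" for x
    using assms[of x "- x"] f0 by (simp add: eq_neg_iff_add_eq_0 add.commute)
  show ?thesis
  proof (cases "c \<ge> 0")
    case True
    then show ?thesis using pos[of "nat c" x] by simp
  next
    case False
    then have "c = - int (nat (- c))" by simp
    then have "c *s x = - (int (nat (- c)) *s x)" "c *s f x = - (int (nat (- c)) *s f x)"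
      by (metis vector_smult_lneg)+
    then show ?thesis by (simp only: pos neg)
  qed
qed

lemma additive_eq_row_action:
  assumes "\<And>x y :: int ^ 'n. f (x + y) = (f x + f y :: int ^ 'm)"
  obtains C where "\<And>m. f m = m v* C"
proof
  fix m :: "int ^ 'n"
  have "f m = f (\<Sum>i\<in>UNIV. m $ i *s axis i 1)"
    by (simp add: basis_expansion)
  also have "\<dots> = (\<Sum>i\<in>UNIV. m $ i *s f (axis i 1))"
    by (simp add: additive_sum[of f] additive_int_scale[of f] assms)
  also have "\<dots> = m v* (\<chi> i. f (axis i 1))"
    by (simp add: vec_eq_iff vector_matrix_mult_def)
  finally show "f m = m v* (\<chi> i. f (axis i 1))" .
qed

lemma matrix_eq_row_action: "(\<And>m :: int ^ 'n. m v* P = m v* Q) \<Longrightarrow> P = Q"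
proof -
  assume *: "\<And>m :: int ^ 'n. m v* P = m v* Q"
  have "axis i 1 v* Z = Z $ i" for i :: 'n and Z :: "int ^ 'm ^ 'n"
    by (simp add: vec_eq_iff vector_matrix_mult_def axis_def if_distrib if_distribR cong: if_cong)
  then show "P = Q" using * by (metis vec_eq_iff)
qed

lemma matrix_power_0 [simp]: "matrix_power A 0 = mat 1"
  and matrix_power_Suc [simp]: "matrix_power A (Suc k) = A ** matrix_power A k"
  by (simp_all add: matrix_power_def)

lemma matrix_power_add: "matrix_power A (i + j) = matrix_power A i ** matrix_power A j"
  by (induction i) (simp_all add: matrix_mul_assoc)

lemma matrix_power_mult: "matrix_power A (i * j) = matrix_power (matrix_power A i) j"
  by (induction j) (simp_all add: matrix_power_add)

lemma matrix_power_intertwine: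
  fixes C :: "'a::comm_ring_1 ^ 'n ^ 'n"
  assumes "map_matrix of_int A ** C = C ** map_matrix of_int B"
  shows "map_matrix of_int (matrix_power A k) ** C = C ** map_matrix of_int (matrix_power B k)"
proof (induction k)
  case (Suc k)
  then show ?case
    by (simp add: map_matrix_of_int_mult) (metis assms matrix_mul_assoc)
qed simp

text \<open>
  Allowing \<open>C\<close> over any commutative ring serves two purposes: the rational case transfers
  annihilating polynomials between similar matrices, the integral case makes the action of a
  conjugating matrix linear over the polynomials.
\<close>

lemma poly_matrix_intertwine:
  fixes C :: "'a::comm_ring_1 ^ 'n ^ 'n"
  assumes "map_matrix of_int A ** C = C ** map_matrix of_int B"
  shows "map_matrix of_int (poly_matrix q A) ** C = C ** map_matrix of_int (poly_matrix q B)"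
  unfolding poly_matrix_def map_matrix_of_int_sum map_matrix_of_int_mult matrix_mult_sum_left
    matrix_mult_sum_right
proof (rule sum.cong[OF refl])
  fix i
  let ?c = "map_matrix of_int (mat (Polynomial.coeff q i)) :: 'a ^ 'n ^ 'n"
  have "?c ** map_matrix of_int (matrix_power A i) ** C
      = ?c ** (C ** map_matrix of_int (matrix_power B i))"
    by (metis matrix_mul_assoc matrix_power_intertwine[OF assms])
  also have "\<dots> = C ** (?c ** map_matrix of_int (matrix_power B i))"
    by (simp add: matrix_mul_assoc matrix_mult_mat)
  finally show "?c ** map_matrix of_int (matrix_power A i) ** C
      = C ** (?c ** map_matrix of_int (matrix_power B i))" .
qed

lemma similar_annihilator_iff:
  fixes A B :: "int ^ 'n ^ 'n"
  assumes "similar_matrices A B"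
  shows "poly_matrix q A = 0 \<longleftrightarrow> poly_matrix q B = 0"
proof -
  obtain C D :: "rat ^ 'n ^ 'n" where C: "map_matrix of_int A ** C = C ** map_matrix of_int B"
    and D: "C ** D = mat 1" "D ** C = mat 1"
    using assms unfolding similar_matrices_def invertible_def by blast
  let ?a = "map_matrix of_int (poly_matrix q A) :: rat ^ 'n ^ 'n"
  let ?b = "map_matrix of_int (poly_matrix q B) :: rat ^ 'n ^ 'n"
  have eq: "?a ** C = C ** ?b" by (rule poly_matrix_intertwine[OF C])
  have zero: "(map_matrix of_int P :: rat ^ 'n ^ 'n) = 0 \<longleftrightarrow> P = 0" for P
    by (simp add: vec_eq_iff)
  have "?a = C ** ?b ** D" "?b = D ** (?a ** C)"
    by (metis eq D matrix_mul_assoc matrix_mul_rid, metis eq D matrix_mul_assoc matrix_mul_lid)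
  then show ?thesis by (metis zero times0_left times0_right)
qed

lemma poly_matrix_extend:
  assumes "Polynomial.degree q \<le> N"
  shows "poly_matrix q A = (\<Sum>i\<le>N. mat (Polynomial.coeff q i) ** matrix_power A i)"
  unfolding poly_matrix_def
  by (rule sum.mono_neutral_left) (use assms in \<open>auto simp: coeff_eq_0\<close>)

lemma poly_matrix_add:
  fixes A :: "int ^ 'n ^ 'n"
  shows "poly_matrix (p + q) A = poly_matrix p A + poly_matrix q A"
proof -
  let ?N = "max (Polynomial.degree p) (Polynomial.degree q)"
  have "mat (a + b) = mat a + (mat b :: int ^ 'n ^ 'n)" for a b
    by (simp add: vec_eq_iff mat_def)
  then show ?thesis
    by (simp add: poly_matrix_extend[of _ ?N] degree_add_le matrix_add_rdistrib sum.distrib)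
qed

lemma poly_matrix_X: "poly_matrix [:0, 1:] A = A"
  by (simp add: poly_matrix_def)

lemma common_denominator:
  fixes f :: "'a::finite \<Rightarrow> rat"
  obtains d :: int and g where "d > 0" "\<And>i. of_int d * f i = of_int (g i)"
proof -
  have "\<exists>d::int. d > 0 \<and> (\<forall>i\<in>I. \<exists>z::int. of_int d * f i = of_int z)" if "finite I" for I
    using that
  proof induction
    case empty
    then show ?case by (intro exI[of _ 1]) simp
  next
    case (insert x I)
    then obtain d where d: "d > 0" "\<And>i. i \<in> I \<Longrightarrow> \<exists>z::int. of_int d * f i = of_int z" by blast
    obtain a b where ab: "quotient_of (f x) = (a, b)" by fastforce
    then have b: "b > 0" "of_int b * f x = of_int a"
      using quotient_of_denom_pos[OF ab] quotient_of_div[OF ab] by auto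
    have "\<exists>z::int. of_int (b * d) * f i = of_int z" if i: "i \<in> insert x I" for i
    proof (cases "i = x")
      case True
      then show ?thesis using b(2) by (intro exI[of _ "d * a"]) (simp flip: b(2))
    next
      case False
      then obtain z :: int where "of_int d * f i = of_int z" using d i by blast
      then show ?thesis by (intro exI[of _ "b * z"]) (simp add: mult.assoc)
    qed
    then show ?case using b(1) d(1) by (intro exI[of _ "b * d"]) simp
  qed
  from this[OF finite, of UNIV] show thesis using that by (metis UNIV_I)
qed

text \<open>
  Over the rationals the injective matrix \<open>D\<close> has a left inverse. If \<open>d\<close> is a common denominator
  of its entries, the inverse times \<open>d\<close> is an integer matrix \<open>F\<close>, and \<open>F ** D = mat d\<close>
  exhibits \<open>d *s m\<close> as the image of \<open>m v* F\<close>.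
\<close>

lemma injective_row_action_cofinite_range:
  fixes D :: "int ^ 'n ^ 'n"
  assumes inj: "\<And>m. m v* D = 0 \<Longrightarrow> m = 0"
  obtains d where "d > 0" "\<And>m. d *s m \<in> range (\<lambda>m. m v* D)"
proof -
  let ?D = "map_matrix of_int D :: rat ^ 'n ^ 'n"
  have "v = 0" if v: "v v* ?D = 0" for v
  proof -
    obtain e g where e: "e > 0" "\<And>i. of_int e * v $ i = of_int (g i)"
      using common_denominator[of "\<lambda>i. v $ i"] by metis
    have "of_int (((\<chi> i. g i) v* D) $ j) = of_int e * (v v* ?D) $ j" for j
      by (simp add: vector_matrix_mult_def sum_distrib_left flip: e(2) mult.assoc)
    then have "(\<chi> i. g i) v* D = 0"
      using v by (simp add: vec_eq_iff)
    then have "g i = 0" for i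
      using inj by (metis vec_lambda_beta zero_index)
    then show "v = 0" using e by (simp add: vec_eq_iff)
  qed
  then have "\<exists>E. E ** transpose ?D = mat 1"
    unfolding matrix_left_invertible_ker by simp
  then obtain E where "E ** ?D = mat 1"
    by (metis matrix_left_right_inverse matrix_transpose_mul transpose_mat transpose_transpose)
  moreover obtain d g where d: "d > 0" "\<And>i. of_int d * E $ fst i $ snd i = of_int (g i)"
    using common_denominator[of "\<lambda>i. E $ fst i $ snd i"] by metis
  define F where "F = (\<chi> i j. g (i, j))"
  have "mat (of_int d) ** E = map_matrix of_int F"
    using d(2)[of "(_, _)"] by (simp add: mat_matrix_mult vec_eq_iff F_def)
  ultimately have "map_matrix of_int (F ** D) = (map_matrix of_int (mat d) :: rat ^ 'n ^ 'n)"
    by (simp add: map_matrix_of_int_mult)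
       (metis matrix_mul_assoc matrix_mul_rid)
  then have "F ** D = mat d" by (simp add: vec_eq_iff mat_def)
  then have "m v* F v* D = d *s m" for m
    by (metis matrix_mul_rid vector_matrix_mul_assoc vector_matrix_mult_mat vector_matrix_mul_rid)
  then show thesis using that d(1) by (metis rangeI)
qed

section \<open>The subgroups N and the multiples of the lattice\<close>

text \<open>
  There are finitely many matrices modulo \<open>d\<close>, so two powers of \<open>A\<close> agree modulo \<open>d\<close>, and the
  smaller one can be cancelled because \<open>A\<close> is invertible over the integers.
\<close>

lemma power_congruent_one:
  fixes A :: "int ^ 'n ^ 'n"
  assumes "invertible A" "d > 0"
  obtains p where "p \<ge> 1" "\<And>K. p dvd K \<Longrightarrow> \<exists>Z. matrix_power A K = mat 1 + mat d ** Z"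
proof -
  obtain A' where A': "A' ** A = mat 1"
    using assms(1) unfolding invertible_def by blast
  let ?M = "(\<lambda>f. (\<chi> i j. f (i, j))) ` ((UNIV :: ('n \<times> 'n) set) \<rightarrow>\<^sub>E {0..<d})"
  have fin: "finite ?M" by (intro finite_imageI finite_PiE) auto
  let ?r = "\<lambda>k. (\<chi> i j. matrix_power A k $ i $ j mod d) :: int ^ 'n ^ 'n"
  have "?r k \<in> ?M" for k
    using assms(2)
    by (intro image_eqI[of _ _ "\<lambda>(i, j). matrix_power A k $ i $ j mod d"]) auto
  then have "\<not> inj ?r"
    using finite_subset[OF _ fin, of "range ?r"] range_inj_infinite by blast
  then obtain i p where p: "p \<ge> 1" "?r i = ?r (i + p)"
    unfolding inj_def by (metis le_add_diff_inverse less_imp_le_nat linorder_neqE_nat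
        Suc_leI One_nat_def zero_less_diff)
  define Z where "Z = (\<chi> a b. (matrix_power A (i + p) $ a $ b - matrix_power A i $ a $ b) div d)"
  have "d dvd matrix_power A (i + p) $ a $ b - matrix_power A i $ a $ b" for a b
    using p(2) by (simp add: vec_eq_iff mod_eq_dvd_iff dvd_diff_commute)
  then have Z: "matrix_power A (i + p) = matrix_power A i + mat d ** Z"
    by (simp add: vec_eq_iff mat_matrix_mult Z_def)
  have inv: "matrix_power A' i ** matrix_power A i = mat 1"
  proof (induction i)
    case (Suc i)
    have "matrix_power A' (Suc i) = matrix_power A' i ** A'"
      using matrix_power_add[of A' i 1] by simp
    then show ?case using Suc A' by simp (metis matrix_mul_assoc matrix_mul_rid)
  qed simp
  have 1: "matrix_power A p = mat 1 + mat d ** (matrix_power A' i ** Z)"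
  proof -
    have "matrix_power A p = matrix_power A' i ** matrix_power A (i + p)"
      by (simp add: matrix_power_add matrix_mul_assoc inv)
    also have "\<dots> = mat 1 + mat d ** (matrix_power A' i ** Z)"
      by (simp add: Z matrix_add_ldistrib inv matrix_mul_assoc matrix_mult_mat)
    finally show ?thesis .
  qed
  have "\<exists>Z. matrix_power A (p * t) = mat 1 + mat d ** Z" for t
  proof (induction t)
    case 0
    then show ?case by (intro exI[of _ 0]) simp
  next
    case (Suc t)
    then obtain Q where "matrix_power A (p * t) = mat 1 + mat d ** Q" by blast
    then have "matrix_power A (p * Suc t) =
        mat 1 + mat d ** (Q + (matrix_power A' i ** Z) ** matrix_power A (p * t))"
      by (simp add: matrix_power_add)
         (simp add: 1 matrix_add_ldistrib matrix_add_rdistrib matrix_mul_assoc)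
    then show ?case by blast
  qed
  then show thesis using that p(1) by (metis dvd_def)
qed

text \<open>
  The factorial in the definition of the subgroups enters here: every period \<open>p \<le> k\<close> divides
  \<open>k!\<close>.
\<close>

lemma pro_subgroup_subset_multiples:
  fixes A :: "int ^ 'n ^ 'n"
  assumes "invertible A" "d > 0"
  obtains p where "p \<ge> 1" "\<And>k m. k \<ge> p \<Longrightarrow> m \<in> pro_subgroup A k \<Longrightarrow> \<exists>w. m = d *s w"
proof -
  obtain p where p: "p \<ge> 1" "\<And>K. p dvd K \<Longrightarrow> \<exists>Z. matrix_power A K = mat 1 + mat d ** Z"
    using power_congruent_one[OF assms] by metis
  have "\<exists>w. m = d *s w" if "k \<ge> p" "m \<in> pro_subgroup A k" for k m
  proof -
    obtain Z where "matrix_power A (fact k) = mat 1 + mat d ** Z"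
      using p \<open>k \<ge> p\<close> by (metis dvd_fact)
    then show ?thesis
      using that(2) by (auto simp: pro_subgroup_def vector_matrix_mult_mat)
  qed
  then show thesis using that p(1) by blast
qed

text \<open>
  If \<open>v\<close> is fixed by the \<open>K\<close>-th power of \<open>A\<close> and \<open>c\<close> is a \<open>K\<close>-th root of unity, the sum
  \<open>w\<^sub>c\<close> of the \<open>c\<^sup>i A\<^sup>i v\<close> for \<open>i < K\<close> satisfies \<open>c A w\<^sub>c = w\<^sub>c\<close>, so it
  vanishes when \<open>A\<close> is hyperbolic. By orthogonality of characters, summing \<open>w\<^sub>c\<close> over all \<open>c\<close>
  gives \<open>K v\<close>.
\<close>

lemma hyperbolic_no_periodic_vector:
  fixes v :: "complex ^ 'n"
  assumes "hyperbolic A" and K: "K \<ge> 1"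
    and v: "map_matrix of_int (matrix_power A K) *v v = v"
  shows "v = 0"
proof -
  let ?A = "map_matrix of_int A :: complex ^ 'n ^ 'n"
  define u where "u i = map_matrix of_int (matrix_power A i) *v v" for i
  define \<omega> where "\<omega> j = cis (2 * pi * real j / real K)" for j
  have u_Suc: "u (Suc i) = ?A *v u i" for i
    by (simp add: u_def map_matrix_of_int_mult matrix_vector_mul_assoc)
  have ends: "u K = u 0" using v by (simp add: u_def)
  have \<omega>K: "\<omega> j ^ K = 1" for j
  proof -
    have "real K * (2 * pi * real j / real K) = 2 * pi * real j" using K by simp
    then have "\<omega> j ^ K = cis (2 * pi * real j)" by (simp only: \<omega>_def Complex.DeMoivre)
    then show ?thesis by (metis cis_multiple_2pi Ints_of_nat mult.commute mult.assoc)
  qed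
  have w0: "(\<Sum>i<K. \<omega> j ^ i *s u i) = 0" for j
  proof (rule ccontr)
    let ?w = "\<Sum>i<K. \<omega> j ^ i *s u i"
    assume "?w \<noteq> 0"
    have "\<omega> j *s (?A *v ?w) = (\<Sum>i<K. \<omega> j ^ Suc i *s u (Suc i))"
      by (simp add: vec.linear_sum[OF matrix_vector_mul_linear_gen] vec.scale_sum_right
          vector_scalar_commute u_Suc)
    also have "\<dots> = ?w"
    proof -
      have "(\<Sum>i<K. g (Suc i)) + g 0 = (\<Sum>i<K. g i) + g K" for g :: "nat \<Rightarrow> complex ^ 'n"
        using sum.lessThan_Suc[of g K] sum.lessThan_Suc_shift[of g K] by (simp add: add.commute)
      from this[of "\<lambda>i. \<omega> j ^ i *s u i"]
      show ?thesis using ends \<omega>K by simp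
    qed
    finally have scaled: "\<omega> j *s (?A *v ?w) = ?w" .
    have "inverse (\<omega> j) * \<omega> j = 1" by (simp add: \<omega>_def cis_mult)
    then have "?A *v ?w = inverse (\<omega> j) *s (\<omega> j *s (?A *v ?w))"
      unfolding vector_smult_assoc by simp
    then have "?A *v ?w = inverse (\<omega> j) *s ?w" unfolding scaled .
    moreover have "cmod (inverse (\<omega> j)) = 1" by (simp add: \<omega>_def norm_inverse)
    ultimately show False using \<open>?w \<noteq> 0\<close> assms(1) unfolding hyperbolic_def by blast
  qed
  have orth: "(\<Sum>j<K. \<omega> j ^ i) = (if i = 0 then of_nat K else 0)" if "i < K" for i
  proof (cases "i = 0")
    case False
    have pw: "\<omega> j ^ i = \<omega> i ^ j" for j by (simp add: \<omega>_def Complex.DeMoivre algebra_simps)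
    have "\<omega> i \<noteq> 1"
    proof
      assume "\<omega> i = 1"
      define x where "x = real i / real K"
      have "cos (2 * pi * x) = 1"
        using arg_cong[OF \<open>\<omega> i = 1\<close>, of Re] by (simp add: \<omega>_def x_def)
      then obtain n :: int where "2 * pi * x = of_int n * 2 * pi"
        using cos_one_2pi_int by auto
      then have "x = of_int n" by simp
      moreover have "0 < x" "x < 1"
        using False that by (simp_all add: x_def)
      ultimately show False by simp
    qed
    then have "(\<Sum>j<K. \<omega> i ^ j) = 0" using \<omega>K[of i] by (simp add: geometric_sum)
    then show ?thesis using False by (simp only: pw if_False)
  qed simp
  have "0 = (\<Sum>j<K. \<Sum>i<K. \<omega> j ^ i *s u i)" by (simp add: w0)
  also have "\<dots> = (\<Sum>i<K. (\<Sum>j<K. \<omega> j ^ i) *s u i)"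
    by (subst sum.swap) (simp add: vec.scale_sum_left)
  also have "\<dots> = (\<Sum>i<K. if i = 0 then of_nat K *s v else 0)"
    by (rule sum.cong) (auto simp: orth u_def)
  also have "\<dots> = of_nat K *s v" using K by simp
  finally show "v = 0" using K by simp
qed

text \<open>
  Hyperbolicity speaks of column vectors whereas the subgroup is a row image, hence the passage
  through a two-sided inverse over the complex numbers.
\<close>

lemma multiples_subset_pro_subgroup:
  fixes A :: "int ^ 'n ^ 'n"
  assumes "hyperbolic A"
  obtains d where "d > 0" "\<And>m. d *s m \<in> pro_subgroup A k"
proof -
  let ?M = "matrix_power A (fact k) - mat 1"
  let ?C = "map_matrix of_int ?M :: complex ^ 'n ^ 'n"
  have "v = 0" if "?C *v v = 0" for v
    using that hyperbolic_no_periodic_vector[OF assms fact_ge_1[of k], of v]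
    by (simp add: map_matrix_of_int_diff matrix_vector_mult_diff_rdistrib)
  then obtain E where "?C ** E = mat 1"
    using matrix_left_invertible_ker[of ?C] matrix_left_right_inverse by blast
  then have inj: "v = 0" if "v v* ?C = 0" for v
    using that by (metis vector_matrix_mul_assoc vector_matrix_mul_rid vector_matrix_mult_0)
  have "m = 0" if "m v* ?M = 0" for m
  proof -
    have "(\<chi> i. of_int (m $ i)) v* ?C = (\<chi> j. of_int ((m v* ?M) $ j))"
      by (simp add: vec_eq_iff vector_matrix_mult_def)
    also have "\<dots> = 0" unfolding that by (simp add: vec_eq_iff)
    finally have "(\<chi> i. complex_of_int (m $ i)) = 0" by (rule inj)
    then show ?thesis by (simp add: vec_eq_iff)
  qed
  then show thesis
    using injective_row_action_cofinite_range[of ?M] that unfolding pro_subgroup_def by metis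
qed

section \<open>Residue classes of polynomials and row modules\<close>

text \<open>
  The quotient ring has sets of polynomials as elements; naming them by a representative allows
  the scalar action to be computed as a matrix product.
\<close>

definition residue_class :: "int ^ 'n ^ 'n \<Rightarrow> int poly \<Rightarrow> int poly set" where
  "residue_class A q = {h + q | h. poly_matrix h A = 0}"

lemma carrier_poly_quot_ring: "carrier (poly_quot_ring A) = range (residue_class A)"
  by (auto simp: poly_quot_ring_def FactRing_def A_RCOSETS_def' a_r_coset_def'
      ring_of_type_algebra_def residue_class_def)

lemma row_module_simps [simp]:
  "carrier (row_module A) = UNIV" "x \<oplus>\<^bsub>row_module A\<^esub> y = x + y"
  by (simp_all add: row_module_def)

text \<open>
  The hypothesis makes the value the same for all members of the class, so that the image in the
  definition of the action is a singleton.
\<close>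

lemma row_module_smult:
  assumes "\<And>h. poly_matrix h A = 0 \<Longrightarrow> poly_matrix h B = 0"
  shows "residue_class A q \<odot>\<^bsub>row_module B\<^esub> m = m v* poly_matrix q B"
proof -
  have "poly_matrix 0 A = 0" by (simp add: poly_matrix_def)
  then have "q \<in> residue_class A q" unfolding residue_class_def by force
  moreover have "m v* poly_matrix q' B = m v* poly_matrix q B" if "q' \<in> residue_class A q" for q'
    using that assms by (auto simp: residue_class_def poly_matrix_add)
  ultimately have "(\<lambda>q. m v* poly_matrix q B) ` residue_class A q = {m v* poly_matrix q B}"
    by blast
  then show ?thesis by (simp add: row_module_def)
qed

section \<open>Finite levels\<close>

lemma pro_subgroup_iff: "x \<in> pro_subgroup A k \<longleftrightarrow> (\<exists>m. x = m v* matrix_power A (fact k) - m)"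
  by (auto simp: pro_subgroup_def vector_matrix_mult_diff_rdistrib)

lemma pro_subgroup_zero: "0 \<in> pro_subgroup A k"
  unfolding pro_subgroup_iff by (intro exI[of _ 0]) simp

lemma pro_subgroup_add:
  assumes "x \<in> pro_subgroup A k" "y \<in> pro_subgroup A k"
  shows "x + y \<in> pro_subgroup A k"
proof -
  obtain a b where "x = a v* matrix_power A (fact k) - a" "y = b v* matrix_power A (fact k) - b"
    using assms unfolding pro_subgroup_iff by blast
  then have "x + y = (a + b) v* matrix_power A (fact k) - (a + b)"
    by (simp add: algebra_simps)
  then show ?thesis unfolding pro_subgroup_iff by blast
qed

lemma pro_subgroup_minus:
  assumes "x \<in> pro_subgroup A k"
  shows "- x \<in> pro_subgroup A k"
proof -
  obtain a where "x = a v* matrix_power A (fact k) - a"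
    using assms unfolding pro_subgroup_iff by blast
  then have "- x = (0 - a) v* matrix_power A (fact k) - (0 - a)"
    by (simp only: vector_matrix_mult_diff_distrib) simp
  then show ?thesis unfolding pro_subgroup_iff by blast
qed

lemma pro_subgroup_diff:
  "x \<in> pro_subgroup A k \<Longrightarrow> y \<in> pro_subgroup A k \<Longrightarrow> x - y \<in> pro_subgroup A k"
  using pro_subgroup_add[of x A k "- y"] pro_subgroup_minus[of y A k] by simp

lemma pro_subgroup_image:
  fixes A B C :: "int ^ 'n ^ 'n"
  assumes "A ** C = C ** B" "x \<in> pro_subgroup A k"
  shows "x v* C \<in> pro_subgroup B k"
proof -
  obtain m where m: "x = m v* matrix_power A (fact k) - m"
    using assms(2) unfolding pro_subgroup_iff by blast
  have "matrix_power A (fact k) ** C = C ** matrix_power B (fact k)"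
    using matrix_power_intertwine[of A C B] assms(1) by simp
  then have "x v* C = (m v* C) v* matrix_power B (fact k) - m v* C"
    by (simp add: m vector_matrix_mult_diff_distrib vector_matrix_mul_assoc)
  then show ?thesis unfolding pro_subgroup_iff by blast
qed

lemma pro_subgroup_poly:
  assumes "x \<in> pro_subgroup A k"
  shows "x v* poly_matrix q A \<in> pro_subgroup A k"
  using poly_matrix_intertwine[of A A A q] by (intro pro_subgroup_image[OF _ assms]) simp

text \<open>
  As \<open>l!\<close> divides \<open>k!\<close>, the matrix \<open>A\<^sup>k\<^sup>! - I\<close> is a telescoping sum of left multiples of
  \<open>A\<^sup>l\<^sup>! - I\<close>.
\<close>

lemma pro_subgroup_antimono:
  assumes "l \<le> k" "x \<in> pro_subgroup A k"
  shows "x \<in> pro_subgroup A l"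
proof -
  let ?P = "matrix_power A (fact l)"
  have step: "m v* matrix_power ?P b - m \<in> pro_subgroup A l" for b m
  proof (induction b)
    case 0
    then show ?case by (simp add: pro_subgroup_zero)
  next
    case (Suc b)
    have "m v* matrix_power ?P (Suc b) = m v* matrix_power ?P b v* ?P"
      using matrix_power_add[of ?P b 1] by (simp add: vector_matrix_mul_assoc)
    then have "m v* matrix_power ?P (Suc b) - m =
        (m v* matrix_power ?P b v* ?P - m v* matrix_power ?P b) + (m v* matrix_power ?P b - m)"
      by simp
    moreover have "m v* matrix_power ?P b v* ?P - m v* matrix_power ?P b \<in> pro_subgroup A l"
      unfolding pro_subgroup_iff by blast
    ultimately show ?case using Suc by (simp only: pro_subgroup_add)
  qed
  obtain b :: nat where "fact k = fact l * b"
    using fact_dvd[OF assms(1), where 'a = nat] by (auto simp: dvd_def)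
  then show ?thesis
    using assms(2) step unfolding pro_subgroup_iff[of x A k] by (auto simp: matrix_power_mult)
qed

lemma pro_class_def': "pro_class A k m = (\<lambda>h. h + m) ` pro_subgroup A k"
  by (auto simp: pro_class_def a_r_coset_def')

lemma mem_pro_class: "x \<in> pro_class A k m \<longleftrightarrow> x - m \<in> pro_subgroup A k"
  unfolding pro_class_def' by (auto simp: image_iff intro: bexI[of _ "x - m"])

lemma pro_class_self: "m \<in> pro_class A k m"
  by (simp add: mem_pro_class pro_subgroup_zero)

lemma pro_class_eq_iff: "pro_class A k m = pro_class A k m' \<longleftrightarrow> m - m' \<in> pro_subgroup A k"
proof
  assume "m - m' \<in> pro_subgroup A k"
  then have "x - m \<in> pro_subgroup A k \<longleftrightarrow> x - m' \<in> pro_subgroup A k" for x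
    using pro_subgroup_add[of "x - m" A k "m - m'"] pro_subgroup_diff[of "x - m'" A k "m - m'"]
    by auto
  then show "pro_class A k m = pro_class A k m'" by (auto simp: mem_pro_class)
qed (metis mem_pro_class pro_class_self)

lemma carrier_pro_quot: "carrier (pro_quot A k) = range (pro_class A k)"
  by (auto simp: pro_quot_def quot_module_def A_RCOSETS_def' pro_class_def)

lemma pro_quot_add:
  "pro_class A k m \<oplus>\<^bsub>pro_quot A k\<^esub> pro_class A k m' = pro_class A k (m + m')"
proof -
  have "pro_class A k m \<oplus>\<^bsub>pro_quot A k\<^esub> pro_class A k m' =
      {a + b | a b. a \<in> pro_class A k m \<and> b \<in> pro_class A k m'}"
    by (auto simp: pro_quot_def quot_module_def set_add_def')
  also have "\<dots> = pro_class A k (m + m')"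
  proof (intro equalityI subsetI)
    fix x assume "x \<in> {a + b | a b. a \<in> pro_class A k m \<and> b \<in> pro_class A k m'}"
    then obtain a b where "x = a + b" "a - m \<in> pro_subgroup A k" "b - m' \<in> pro_subgroup A k"
      by (auto simp: mem_pro_class)
    then show "x \<in> pro_class A k (m + m')"
      using pro_subgroup_add[of "a - m" A k "b - m'"] by (simp add: mem_pro_class algebra_simps)
  next
    fix x assume "x \<in> pro_class A k (m + m')"
    then have "x - m' \<in> pro_class A k m" by (simp add: mem_pro_class algebra_simps)
    moreover have "x = (x - m') + m'" by simp
    ultimately show "x \<in> {a + b | a b. a \<in> pro_class A k m \<and> b \<in> pro_class A k m'}"
      using pro_class_self by blast
  qed
  finally show ?thesis .
qed

lemma pro_quot_smult:
  assumes "\<And>h. poly_matrix h A = 0 \<Longrightarrow> poly_matrix h B = 0"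
  shows "residue_class A q \<odot>\<^bsub>pro_quot B k\<^esub> pro_class B k m = pro_class B k (m v* poly_matrix q B)"
proof -
  have const: "pro_class B k (x v* poly_matrix q B) = pro_class B k (m v* poly_matrix q B)"
    if "x \<in> pro_class B k m" for x
  proof -
    have "(x - m) v* poly_matrix q B \<in> pro_subgroup B k"
      by (rule pro_subgroup_poly) (use that in \<open>simp only: mem_pro_class\<close>)
    then show ?thesis by (simp only: pro_class_eq_iff vector_matrix_mult_diff_distrib)
  qed
  have "residue_class A q \<odot>\<^bsub>pro_quot B k\<^esub> pro_class B k m =
      (\<Union>x\<in>pro_class B k m. pro_class B k (x v* poly_matrix q B))"
    by (simp add: pro_quot_def quot_module_def pro_class_def row_module_smult[OF assms])
  also have "\<dots> = pro_class B k (m v* poly_matrix q B)"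
    using const pro_class_self[of m B k] by blast
  finally show ?thesis .
qed

lemma pro_map_pro_class:
  assumes "l \<le> k"
  shows "pro_map A l (pro_class A k m) = pro_class A l m"
proof -
  have "pro_class A l x = pro_class A l m" if "x \<in> pro_class A k m" for x
    using that pro_subgroup_antimono[OF assms] by (simp add: pro_class_eq_iff mem_pro_class)
  then show ?thesis unfolding pro_map_def using pro_class_self[of m A k] by blast
qed

section \<open>The profinite module through coherent sequences\<close>

text \<open>
  An element of the inverse limit is determined by a sequence of representatives. Calculating with
  such sequences replaces calculating with families of cosets.
\<close>

definition coherent :: "int ^ 'n ^ 'n \<Rightarrow> (nat \<Rightarrow> int ^ 'n) \<Rightarrow> bool" where
  "coherent A s \<longleftrightarrow> (\<forall>k l. 1 \<le> l \<and> l \<le> k \<longrightarrow> s k - s l \<in> pro_subgroup A l)"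

definition pro_point :: "int ^ 'n ^ 'n \<Rightarrow> (nat \<Rightarrow> int ^ 'n) \<Rightarrow> nat \<Rightarrow> (int ^ 'n) set" where
  "pro_point A s = (\<lambda>k\<in>{1..}. pro_class A k (s k))"

lemma pro_point_eq_iff:
  "pro_point A s = pro_point A t \<longleftrightarrow> (\<forall>k\<ge>1. s k - t k \<in> pro_subgroup A k)"
  by (auto simp: pro_point_def restrict_def fun_eq_iff simp flip: pro_class_eq_iff)

lemma carrier_profinite_module: "carrier (profinite_module A) = pro_point A ` {s. coherent A s}"
proof (intro equalityI subsetI)
  fix g assume g: "g \<in> carrier (profinite_module A)"
  then have P: "g \<in> (\<Pi>\<^sub>E k\<in>{1..}. range (pro_class A k))"
    and compat: "\<And>k l. 1 \<le> l \<Longrightarrow> l \<le> k \<Longrightarrow> pro_map A l (g k) = g l"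
    by (auto simp: profinite_module_def carrier_pro_quot)
  from P have "\<forall>k. \<exists>m. k \<ge> 1 \<longrightarrow> g k = pro_class A k m" by (auto simp: PiE_def Pi_def)
  then obtain s where s: "\<And>k. k \<ge> 1 \<Longrightarrow> g k = pro_class A k (s k)" by metis
  have "g = pro_point A s"
    using P by (auto simp: pro_point_def s PiE_def extensional_def fun_eq_iff)
  moreover have "coherent A s"
    unfolding coherent_def
    using compat s by (metis le_trans pro_class_eq_iff pro_map_pro_class)
  ultimately show "g \<in> pro_point A ` {s. coherent A s}" by blast
next
  fix g assume "g \<in> pro_point A ` {s. coherent A s}"
  then obtain s where g: "g = pro_point A s" and s: "coherent A s" by blast
  have "pro_map A l (g k) = g l" if "1 \<le> l" "l \<le> k" for k l
    using s that by (simp add: g pro_point_def coherent_def pro_map_pro_class pro_class_eq_iff)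
  then show "g \<in> carrier (profinite_module A)"
    by (simp add: profinite_module_def carrier_pro_quot) (simp add: g pro_point_def)
qed

lemma pro_point_add:
  "pro_point A s \<oplus>\<^bsub>profinite_module A\<^esub> pro_point A t = pro_point A (\<lambda>k. s k + t k)"
  by (auto simp: profinite_module_def pro_point_def pro_quot_add fun_eq_iff)

lemma pro_point_smult:
  assumes "\<And>h. poly_matrix h A = 0 \<Longrightarrow> poly_matrix h B = 0"
  shows "residue_class A q \<odot>\<^bsub>profinite_module B\<^esub> pro_point B s =
    pro_point B (\<lambda>k. s k v* poly_matrix q B)"
  by (auto simp: profinite_module_def pro_point_def pro_quot_smult[OF assms] fun_eq_iff)

lemma profinite_embedding_eq: "profinite_embedding A m = pro_point A (\<lambda>_. m)"
  by (simp add: profinite_embedding_def pro_point_def)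

lemma profinite_embedding_carrier: "profinite_embedding A m \<in> carrier (profinite_module A)"
  unfolding carrier_profinite_module profinite_embedding_eq
  by (auto simp: coherent_def pro_subgroup_zero)

lemma profinite_embedding_add:
  "profinite_embedding A x \<oplus>\<^bsub>profinite_module A\<^esub> profinite_embedding A y =
   profinite_embedding A (x + y)"
  by (simp add: profinite_embedding_eq pro_point_add)

lemma profinite_embedding_smult:
  assumes "\<And>h. poly_matrix h A = 0 \<Longrightarrow> poly_matrix h B = 0"
  shows "residue_class A q \<odot>\<^bsub>profinite_module B\<^esub> profinite_embedding B m =
    profinite_embedding B (m v* poly_matrix q B)"
  by (simp add: profinite_embedding_eq pro_point_smult[OF assms])

text \<open>
  A vector in all the subgroups is divisible by every positive integer, so each of its entries is
  divisible by an integer that exceeds it in absolute value.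
\<close>

lemma inj_profinite_embedding:
  fixes A :: "int ^ 'n ^ 'n"
  assumes "invertible A"
  shows "inj (profinite_embedding A)"
proof (rule injI)
  fix x y assume "profinite_embedding A x = profinite_embedding A y"
  then have N: "x - y \<in> pro_subgroup A k" if "k \<ge> 1" for k
    using that by (simp add: profinite_embedding_eq pro_point_eq_iff)
  have "(x - y) $ i = 0" for i
  proof -
    define d where "d = \<bar>(x - y) $ i\<bar> + 1"
    have "d > 0" by (simp add: d_def)
    then obtain p where "p \<ge> 1" "\<And>k m. k \<ge> p \<Longrightarrow> m \<in> pro_subgroup A k \<Longrightarrow> \<exists>w. m = d *s w"
      using pro_subgroup_subset_multiples[OF assms] by metis
    then obtain w where "x - y = d *s w" using N by blast
    then have "d dvd (x - y) $ i" by (metis dvd_triv_left vector_smult_component)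
    then show ?thesis using dvd_imp_le_int[of "(x - y) $ i" d] by (auto simp: d_def)
  qed
  then show "x = y" by (simp add: vec_eq_iff)
qed

text \<open>
  The quotient of the profinite module by the lattice is torsion-free. Suppose the \<open>d\<close>-fold multiple
  of a coherent sequence \<open>s\<close> represents the lattice vector \<open>m\<close>. At a level where the
  subgroup consists of multiples of \<open>d\<close> this gives \<open>m = d *s y\<close>. Then \<open>d *s (s k - y)\<close> lies in the
  \<open>k\<close>-th subgroup for all \<open>k\<close>. Given \<open>l\<close>, let the \<open>l\<close>-th subgroup contain all multiples of \<open>e\<close>;
  at a level \<open>k\<close> where the subgroup consists of multiples of \<open>d * e\<close>, dividing by \<open>d\<close> shows
  that \<open>s k - y\<close>, and with it \<open>s l - y\<close>, lies in the \<open>l\<close>-th subgroup. So \<open>s\<close> represents \<open>y\<close>.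
\<close>

lemma pro_point_multiple_in_lattice:
  fixes B :: "int ^ 'n ^ 'n"
  assumes "invertible B" "hyperbolic B" "coherent B s" "d > 0"
    and eq: "pro_point B (\<lambda>k. d *s s k) = profinite_embedding B m"
  shows "pro_point B s \<in> range (profinite_embedding B)"
proof -
  have dm: "d *s s k - m \<in> pro_subgroup B k" if "k \<ge> 1" for k
    using eq that by (simp add: profinite_embedding_eq pro_point_eq_iff)
  obtain p where p: "p \<ge> 1" "\<And>k m. k \<ge> p \<Longrightarrow> m \<in> pro_subgroup B k \<Longrightarrow> \<exists>w. m = d *s w"
    using pro_subgroup_subset_multiples[OF assms(1,4)] by metis
  obtain w where w: "d *s s p - m = d *s w" using dm p by blast
  define y where "y = s p - w"
  have y: "m = d *s y"
    using w by (simp add: y_def vector_ssub_ldistrib algebra_simps)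
  have "s l - y \<in> pro_subgroup B l" if "l \<ge> 1" for l
  proof -
    obtain e where e: "e > 0" "\<And>x. e *s x \<in> pro_subgroup B l"
      using multiples_subset_pro_subgroup[OF assms(2)] by metis
    have "d * e > 0" using e(1) assms(4) by simp
    then obtain p' where p': "\<And>k m. k \<ge> p' \<Longrightarrow> m \<in> pro_subgroup B k \<Longrightarrow> \<exists>w. m = (d * e) *s w"
      using pro_subgroup_subset_multiples[OF assms(1)] by metis
    define k where "k = max l p'"
    have "d *s s k - m \<in> pro_subgroup B k" using dm that by (simp add: k_def)
    then obtain u where "d *s s k - m = (d * e) *s u" using p'[of k] by (auto simp: k_def)
    then have "d *s (s k - y) = d *s (e *s u)"
      by (simp add: y vector_ssub_ldistrib vector_smult_assoc)
    then have "d * (s k - y) $ i = d * (e *s u) $ i" for i by (metis vector_smult_component)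
    then have "s k - y = e *s u" using assms(4) by (simp add: vec_eq_iff)
    then have "s k - y \<in> pro_subgroup B l" using e(2) by simp
    moreover have "s k - s l \<in> pro_subgroup B l"
      using assms(3) that unfolding coherent_def by (simp add: k_def)
    ultimately show ?thesis using pro_subgroup_diff by fastforce
  qed
  then have "pro_point B s = profinite_embedding B y"
    by (simp add: profinite_embedding_eq pro_point_eq_iff)
  then show ?thesis by simp
qed

section \<open>Conjugate matrices have isomorphic profinite modules\<close>

text \<open>
  Taking images of cosets as sets gives a map that needs no choice of representatives and acts on
  each coordinate separately, so that it is visibly continuous.
\<close>

definition induced_map ::
    "int ^ 'n ^ 'n \<Rightarrow> (nat \<Rightarrow> (int ^ 'n) set) \<Rightarrow> nat \<Rightarrow> (int ^ 'n) set" where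
  "induced_map C g = (\<lambda>k\<in>{1..}. (\<lambda>m. m v* C) ` g k)"

text \<open>
  The inclusion of the left side in the right holds for any intertwining \<open>C\<close>. For the other, the
  inverse \<open>D\<close> intertwines in the opposite direction and brings the coset back.
\<close>

lemma pro_class_image:
  fixes A B C :: "int ^ 'n ^ 'n"
  assumes AC: "A ** C = C ** B" and CD: "C ** D = mat 1" "D ** C = mat 1"
  shows "(\<lambda>m. m v* C) ` pro_class A k m = pro_class B k (m v* C)"
proof (intro equalityI subsetI)
  fix y assume "y \<in> (\<lambda>m. m v* C) ` pro_class A k m"
  then obtain x where "y = x v* C" "x - m \<in> pro_subgroup A k" by (auto simp: mem_pro_class)
  then show "y \<in> pro_class B k (m v* C)"
    using pro_subgroup_image[OF AC, of "x - m" k]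
    by (simp add: mem_pro_class vector_matrix_mult_diff_distrib)
next
  fix y assume "y \<in> pro_class B k (m v* C)"
  then have y: "y - m v* C \<in> pro_subgroup B k" by (simp add: mem_pro_class)
  have BD: "B ** D = D ** A"
    by (metis AC CD matrix_mul_assoc matrix_mul_lid matrix_mul_rid)
  have "(y - m v* C) v* D = y v* D - m"
    by (simp only: vector_matrix_mult_diff_distrib vector_matrix_mul_assoc CD vector_matrix_mul_rid)
  then have "y v* D \<in> pro_class A k m"
    using pro_subgroup_image[OF BD y] by (simp add: mem_pro_class)
  moreover have "y = y v* D v* C"
    by (simp only: vector_matrix_mul_assoc CD vector_matrix_mul_rid)
  ultimately show "y \<in> (\<lambda>m. m v* C) ` pro_class A k m" by blast
qed

lemma induced_map_pro_point:
  fixes A B C :: "int ^ 'n ^ 'n"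
  assumes "A ** C = C ** B" "C ** D = mat 1" "D ** C = mat 1"
  shows "induced_map C (pro_point A s) = pro_point B (\<lambda>k. s k v* C)"
  by (simp add: induced_map_def pro_point_def pro_class_image[OF assms] fun_eq_iff)

lemma coherent_image:
  fixes A B C :: "int ^ 'n ^ 'n"
  assumes "A ** C = C ** B" "coherent A s"
  shows "coherent B (\<lambda>k. s k v* C)"
  using pro_subgroup_image[OF assms(1)] assms(2)
  by (simp add: coherent_def flip: vector_matrix_mult_diff_distrib)

lemma induced_map_carrier:
  fixes A B C :: "int ^ 'n ^ 'n"
  assumes "A ** C = C ** B" "C ** D = mat 1" "D ** C = mat 1"
    and "g \<in> carrier (profinite_module A)"
  shows "induced_map C g \<in> carrier (profinite_module B)"
  using assms(4) coherent_image[OF assms(1)]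
  unfolding carrier_profinite_module by (auto simp: induced_map_pro_point[OF assms(1-3)])

lemma induced_map_inverse:
  fixes A B C :: "int ^ 'n ^ 'n"
  assumes AC: "A ** C = C ** B" and CD: "C ** D = mat 1" "D ** C = mat 1"
    and g: "g \<in> carrier (profinite_module A)"
  shows "induced_map D (induced_map C g) = g"
proof -
  have BD: "B ** D = D ** A"
    by (metis AC CD matrix_mul_assoc matrix_mul_lid matrix_mul_rid)
  obtain s where "g = pro_point A s" using g unfolding carrier_profinite_module by blast
  then show ?thesis
    by (simp add: induced_map_pro_point[OF AC CD] induced_map_pro_point[OF BD CD(2,1)]
        vector_matrix_mul_assoc CD)
qed

lemma topspace_profinite_topology: "topspace (profinite_topology A) = carrier (profinite_module A)"
proof -
  have "carrier (profinite_module A) \<subseteq> (\<Pi>\<^sub>E k\<in>{1..}. carrier (pro_quot A k))"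
    by (auto simp: profinite_module_def)
  then show ?thesis by (auto simp: profinite_topology_def)
qed

lemma continuous_map_induced_map:
  fixes A B C :: "int ^ 'n ^ 'n"
  assumes "A ** C = C ** B" "C ** D = mat 1" "D ** C = mat 1"
  shows "continuous_map (profinite_topology A) (profinite_topology B) (induced_map C)"
proof -
  have "continuous_map (profinite_topology A) (discrete_topology (carrier (pro_quot B k)))
      (\<lambda>g. induced_map C g k)" if "k \<in> {1..}" for k
  proof -
    have "continuous_map (profinite_topology A) (discrete_topology (carrier (pro_quot A k))) (\<lambda>g. g k)"
      unfolding profinite_topology_def
      by (intro continuous_map_from_subtopology continuous_map_product_projection that)
    moreover have "continuous_map (discrete_topology (carrier (pro_quot A k)))
        (discrete_topology (carrier (pro_quot B k))) (image (\<lambda>m. m v* C))"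
      by (auto simp: carrier_pro_quot pro_class_image[OF assms])
    ultimately have "continuous_map (profinite_topology A)
        (discrete_topology (carrier (pro_quot B k))) (image (\<lambda>m. m v* C) \<circ> (\<lambda>g. g k))"
      by (rule continuous_map_compose)
    then show ?thesis using that by (simp add: induced_map_def o_def)
  qed
  moreover have "induced_map C ` topspace (profinite_topology A) \<subseteq> extensional {1..}"
    by (auto simp: induced_map_def)
  moreover have "induced_map C \<in> topspace (profinite_topology A) \<rightarrow> carrier (profinite_module B)"
    using induced_map_carrier[OF assms] by (simp add: topspace_profinite_topology)
  ultimately show ?thesis
    unfolding profinite_topology_def[of B] continuous_map_in_subtopology continuous_map_componentwise
    by blast
qed

lemma profinite_iso_induced_map:
  fixes A B C :: "int ^ 'n ^ 'n"
  assumes AC: "A ** C = C ** B" and CD: "C ** D = mat 1" "D ** C = mat 1"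
    and ann: "\<And>h. poly_matrix h A = 0 \<Longrightarrow> poly_matrix h B = 0"
  shows "profinite_iso A B (induced_map C)"
proof -
  let ?A = "profinite_module A" and ?B = "profinite_module B"
  have BD: "B ** D = D ** A"
    by (metis AC CD matrix_mul_assoc matrix_mul_lid matrix_mul_rid)
  note ind = induced_map_pro_point[OF AC CD]
  have bij: "bij_betw (induced_map C) (carrier ?A) (carrier ?B)"
    by (rule bij_betw_byWitness[where f' = "induced_map D"])
      (use induced_map_inverse[OF AC CD] induced_map_inverse[OF BD CD(2,1)]
        induced_map_carrier[OF AC CD] induced_map_carrier[OF BD CD(2,1)] in auto)
  have add: "induced_map C (x \<oplus>\<^bsub>?A\<^esub> y) = induced_map C x \<oplus>\<^bsub>?B\<^esub> induced_map C y"
    if "x \<in> carrier ?A" "y \<in> carrier ?A" for x y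
    using that unfolding carrier_profinite_module
    by (auto simp: pro_point_add ind vector_matrix_left_distrib)
  have smult: "induced_map C (r \<odot>\<^bsub>?A\<^esub> x) = r \<odot>\<^bsub>?B\<^esub> induced_map C x"
    if "r \<in> carrier (poly_quot_ring A)" "x \<in> carrier ?A" for r x
  proof -
    obtain q s where "r = residue_class A q" "x = pro_point A s"
      using \<open>r \<in> _\<close> \<open>x \<in> _\<close> unfolding carrier_poly_quot_ring carrier_profinite_module by blast
    moreover have "poly_matrix q A ** C = C ** poly_matrix q B"
      using poly_matrix_intertwine[of A C B q] AC by simp
    ultimately show ?thesis
      by (simp add: pro_point_smult ann ind vector_matrix_mul_assoc)
  qed
  have "homeomorphic_maps (profinite_topology A) (profinite_topology B)
      (induced_map C) (induced_map D)"
    unfolding homeomorphic_maps_def topspace_profinite_topology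
    using continuous_map_induced_map[OF AC CD] continuous_map_induced_map[OF BD CD(2,1)]
      induced_map_inverse[OF AC CD] induced_map_inverse[OF BD CD(2,1)] by blast
  then have "homeomorphic_map (profinite_topology A) (profinite_topology B) (induced_map C)"
    by (rule homeomorphic_maps_imp_map)
  moreover have "induced_map C \<in> module_iso (poly_quot_ring A) ?A ?B"
    using bij add smult by (auto simp: module_iso_def iso_def hom_def bij_betw_def)
  ultimately show ?thesis by (simp add: profinite_iso_def)
qed

section \<open>Recovering conjugacy from the profinite modules\<close>

lemma lattice_module_iso:
  fixes B :: "int ^ 'n ^ 'n"
  assumes "invertible B" and ann: "\<And>h. poly_matrix h A = 0 \<Longrightarrow> poly_matrix h B = 0"
  shows "inv_into UNIV (profinite_embedding B) \<in> module_iso (poly_quot_ring A)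
    ((profinite_module B)\<lparr>carrier := range (profinite_embedding B)\<rparr>) (row_module B)"
proof -
  note inj = inj_profinite_embedding[OF assms(1)]
  have "bij_betw (inv_into UNIV (profinite_embedding B)) (range (profinite_embedding B)) UNIV"
    by (intro bij_betw_inv_into inj_on_imp_bij_betw inj)
  then show ?thesis
    by (auto simp: module_iso_def iso_def hom_def carrier_poly_quot_ring inj inv_f_f
        profinite_embedding_add profinite_embedding_smult[OF ann] row_module_smult[OF ann])
qed

text \<open>
  An additive map between lattices is the action of the matrix whose rows are the images of the
  standard basis; the inverse of a bijective one is additive too, which makes the matrix
  invertible over the integers.
\<close>

lemma equivariant_bijection_conjugate:
  fixes A B :: "int ^ 'n ^ 'n"
  assumes bij: "bij h" and add: "\<And>x y. h (x + y) = h x + h y"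
    and equivariant: "\<And>m. h (m v* A) = h m v* B"
  shows "conjugate_matrices A B"
proof -
  obtain C where C: "\<And>m. h m = m v* C"
    using additive_eq_row_action[of h, OF add] by blast
  have "inv_into UNIV h (x + y) = inv_into UNIV h x + inv_into UNIV h y" for x y
    using bij add by (metis bij_inv_eq_iff)
  then obtain D where D: "\<And>m. inv_into UNIV h m = m v* D"
    using additive_eq_row_action[of "inv_into UNIV h"] by blast
  have "C ** D = mat 1" "D ** C = mat 1"
    using bij C D
    by (auto intro!: matrix_eq_row_action simp flip: vector_matrix_mul_assoc)
       (metis bij_inv_eq_iff)+
  moreover have "A ** C = C ** B"
    using equivariant C by (intro matrix_eq_row_action) (simp flip: vector_matrix_mul_assoc)
  ultimately show ?thesis unfolding conjugate_matrices_def invertible_def by blast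
qed

text \<open>
  In the proof \<open>\<psi>\<close> is \<open>\<Psi>\<close> restricted to the lattice of \<open>A\<close>, and \<open>\<phi>\<close> embeds the lattice of \<open>B\<close>
  into that of \<open>A\<close> by running \<open>f\<close> and then \<open>\<psi>\<close> backwards. The range of \<open>\<phi>\<close> has full
  rank and is sent into the lattice of \<open>B\<close> by \<open>\<psi>\<close>; torsion-freeness extends this to the
  whole lattice, so that \<open>f \<circ> \<psi>\<close> is an equivariant bijection of lattices.
\<close>

lemma lattice_intersection_free_conjugate:
  fixes A B :: "int ^ 'n ^ 'n"
  assumes invertible: "invertible A" "invertible B" and hyperbolic: "hyperbolic B"
    and ann: "\<And>h. poly_matrix h A = 0 \<Longrightarrow> poly_matrix h B = 0"
    and \<Psi>: "\<Psi> \<in> module_iso (poly_quot_ring A) (profinite_module A) (profinite_module B)"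
    and f: "f \<in> module_iso (poly_quot_ring A)
      ((profinite_module B)\<lparr>carrier :=
        \<Psi> ` range (profinite_embedding A) \<inter> range (profinite_embedding B)\<rparr>) (row_module B)"
  shows "conjugate_matrices A B"
proof -
  let ?eA = "profinite_embedding A" and ?eB = "profinite_embedding B"
  define J where "J = \<Psi> ` range ?eA \<inter> range ?eB"
  define \<psi> where "\<psi> m = \<Psi> (?eA m)" for m
  have \<Psi>_inj: "inj_on \<Psi> (carrier (profinite_module A))"
    and \<Psi>_carrier: "\<And>x. x \<in> carrier (profinite_module A) \<Longrightarrow> \<Psi> x \<in> carrier (profinite_module B)"
    and \<Psi>_add: "\<And>x y. x \<in> carrier (profinite_module A) \<Longrightarrow> y \<in> carrier (profinite_module A) \<Longrightarrow>
      \<Psi> (x \<oplus>\<^bsub>profinite_module A\<^esub> y) = \<Psi> x \<oplus>\<^bsub>profinite_module B\<^esub> \<Psi> y"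
    and \<Psi>_smult: "\<And>q x. x \<in> carrier (profinite_module A) \<Longrightarrow>
      \<Psi> (residue_class A q \<odot>\<^bsub>profinite_module A\<^esub> x) =
      residue_class A q \<odot>\<^bsub>profinite_module B\<^esub> \<Psi> x"
    using \<Psi> by (auto simp: module_iso_def iso_def hom_def bij_betw_def carrier_poly_quot_ring)
  have \<psi>_carrier: "\<psi> m \<in> carrier (profinite_module B)" for m
    by (simp add: \<psi>_def \<Psi>_carrier profinite_embedding_carrier)
  have \<psi>_inj: "inj \<psi>"
    using inj_profinite_embedding[OF invertible(1)] \<Psi>_inj profinite_embedding_carrier[of A]
    unfolding \<psi>_def inj_def inj_on_def by blast
  have \<psi>_add: "\<psi> (x + y) = \<psi> x \<oplus>\<^bsub>profinite_module B\<^esub> \<psi> y" for x y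
    by (simp add: \<psi>_def \<Psi>_add profinite_embedding_carrier flip: profinite_embedding_add)
  have \<psi>_smult: "residue_class A q \<odot>\<^bsub>profinite_module B\<^esub> \<psi> m = \<psi> (m v* poly_matrix q A)" for q m
    by (simp add: \<psi>_def profinite_embedding_carrier profinite_embedding_smult flip: \<Psi>_smult)
  have f_bij: "bij_betw f J UNIV"
    and f_add: "\<And>x y. x \<in> J \<Longrightarrow> y \<in> J \<Longrightarrow> f (x \<oplus>\<^bsub>profinite_module B\<^esub> y) = f x + f y"
    and f_smult: "\<And>q x. x \<in> J \<Longrightarrow>
      f (residue_class A q \<odot>\<^bsub>profinite_module B\<^esub> x) = f x v* poly_matrix q B"
    using f by (auto simp: module_iso_def iso_def hom_def carrier_poly_quot_ring J_def
        row_module_smult[OF ann])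
  define \<phi> where "\<phi> m = inv_into UNIV \<psi> (inv_into J f m)" for m
  have range_\<psi>: "\<Psi> ` range ?eA = range \<psi>" by (auto simp: \<psi>_def)
  have J_sub: "J \<subseteq> range \<psi>" "J \<subseteq> range ?eB" by (auto simp: J_def \<psi>_def)
  have g_J: "inv_into J f m \<in> J" for m
    using f_bij by (metis UNIV_I bij_betw_def inv_into_into)
  have \<psi>\<phi>: "\<psi> (\<phi> m) = inv_into J f m" for m
    unfolding \<phi>_def using g_J J_sub by (meson f_inv_into_f subsetD)
  then have \<psi>\<phi>_J: "\<psi> (\<phi> m) \<in> J" for m by (simp add: g_J)
  have f\<psi>\<phi>: "f (\<psi> (\<phi> m)) = m" for m
    using f_bij by (simp add: \<psi>\<phi> bij_betw_inv_into_right)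
  have J_add: "x \<oplus>\<^bsub>profinite_module B\<^esub> y \<in> J" if "x \<in> J" "y \<in> J" for x y
  proof -
    obtain a b where "x = ?eB a" "y = ?eB b" using \<open>x \<in> J\<close> \<open>y \<in> J\<close> J_sub(2) by blast
    then have "x \<oplus>\<^bsub>profinite_module B\<^esub> y \<in> range ?eB"
      by (simp add: profinite_embedding_add)
    moreover obtain a b where "x = \<psi> a" "y = \<psi> b"
      using \<open>x \<in> J\<close> \<open>y \<in> J\<close> J_sub(1) by blast
    then have "x \<oplus>\<^bsub>profinite_module B\<^esub> y \<in> range \<psi>" by (simp flip: \<psi>_add)
    ultimately show ?thesis by (simp add: J_def range_\<psi>)
  qed
  have \<phi>_add: "\<phi> (x + y) = \<phi> x + \<phi> y" for x y
  proof -
    have "\<psi> (\<phi> x + \<phi> y) \<in> J" by (simp add: \<psi>_add J_add \<psi>\<phi>_J)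
    moreover have "f (\<psi> (\<phi> x + \<phi> y)) = f (\<psi> (\<phi> (x + y)))"
      by (simp add: \<psi>_add f_add \<psi>\<phi>_J f\<psi>\<phi>)
    ultimately have "\<psi> (\<phi> x + \<phi> y) = \<psi> (\<phi> (x + y))"
      using f_bij \<psi>\<phi>_J by (metis bij_betw_def inj_onD)
    then show ?thesis using \<psi>_inj by (metis injD)
  qed
  obtain D where D: "\<And>m. \<phi> m = m v* D"
    using additive_eq_row_action[of \<phi>, OF \<phi>_add] by blast
  have "m = 0" if "m v* D = 0" for m
    using that D f\<psi>\<phi> by (metis vector_matrix_mult_0)
  then obtain d where d: "d > 0" "\<And>m. d *s m \<in> range (\<lambda>m. m v* D)"
    using injective_row_action_cofinite_range[of D] by metis
  have \<psi>_lattice: "\<psi> m \<in> range ?eB" for m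
  proof -
    obtain s where s: "coherent B s" "\<psi> m = pro_point B s"
      using \<psi>_carrier[of m] unfolding carrier_profinite_module by blast
    \<comment> \<open>Multiplication by \<open>d\<close> is the scalar action of a constant polynomial, with which \<open>\<Psi>\<close> commutes.\<close>
    have const: "x v* poly_matrix [:d:] M = d *s x" for x and M :: "int ^ 'n ^ 'n"
      using vector_matrix_mult_mat[of x d "mat 1 :: int ^ 'n ^ 'n"] by (simp add: poly_matrix_def)
    have "pro_point B (\<lambda>k. d *s s k) = \<psi> (d *s m)"
      using \<psi>_smult[of "[:d:]" m] by (simp add: s(2) pro_point_smult[OF ann] const)
    moreover have "\<psi> (d *s m) \<in> range ?eB"
      using d(2)[of m] \<psi>\<phi>_J J_sub(2) D by (metis rangeE subsetD)
    ultimately show ?thesis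
      using pro_point_multiple_in_lattice[OF invertible(2) hyperbolic s(1) d(1)] s(2) by auto
  qed
  then have J: "J = range \<psi>" by (auto simp: J_def range_\<psi>)
  have "bij_betw \<psi> UNIV J" unfolding J by (rule inj_on_imp_bij_betw[OF \<psi>_inj])
  then have "bij (f \<circ> \<psi>)" using f_bij by (rule bij_betw_trans)
  moreover have "(f \<circ> \<psi>) (x + y) = (f \<circ> \<psi>) x + (f \<circ> \<psi>) y" for x y
    by (simp add: \<psi>_add f_add J)
  \<comment> \<open>The class of the polynomial \<open>x\<close> acts through the matrix itself.\<close>
  moreover have "(f \<circ> \<psi>) (m v* A) = (f \<circ> \<psi>) m v* B" for m
    using f_smult[of "\<psi> m" "[:0, 1:]"] \<psi>_smult[of "[:0, 1:]" m] by (simp add: J poly_matrix_X)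
  ultimately show ?thesis by (rule equivariant_bijection_conjugate)
qed

theorem theorem6p2:
  fixes A B :: "int ^ 'n ^ 'n"
  assumes "invertible A" and "invertible B"
    and "hyperbolic A" and "hyperbolic B"
    and "similar_matrices A B"
  shows
    "(conjugate_matrices A B \<longleftrightarrow>
        (\<exists>\<Psi>. profinite_iso A B \<Psi> \<and>
             \<Psi> ` range (profinite_embedding A) = range (profinite_embedding B))) \<and>
     (conjugate_matrices A B \<longleftrightarrow>
        (\<exists>\<Psi>. profinite_iso A B \<Psi> \<and>
             (\<exists>f. f \<in> module_iso (poly_quot_ring A)
                       ((profinite_module B)\<lparr>carrier :=
                          \<Psi> ` range (profinite_embedding A) \<inter> range (profinite_embedding B)\<rparr>)
                       (row_module B))))"
    (is "(?a \<longleftrightarrow> ?b) \<and> (?a \<longleftrightarrow> ?c)")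
proof -
  have ann: "\<And>h. poly_matrix h A = 0 \<Longrightarrow> poly_matrix h B = 0"
    using similar_annihilator_iff[OF assms(5)] by blast
  have "?b" if ?a
  proof -
    obtain C D :: "int ^ 'n ^ 'n"
      where AC: "A ** C = C ** B" and CD: "C ** D = mat 1" "D ** C = mat 1"
      using \<open>?a\<close> unfolding conjugate_matrices_def invertible_def by blast
    have *: "induced_map C (profinite_embedding A m) = profinite_embedding B (m v* C)" for m
      by (simp add: profinite_embedding_eq induced_map_pro_point[OF AC CD])
    have "m = m v* D v* C" for m :: "int ^ 'n"
      by (simp add: vector_matrix_mul_assoc CD)
    then have "profinite_embedding B m = induced_map C (profinite_embedding A (m v* D))" for m
      by (metis *)
    then have "induced_map C ` range (profinite_embedding A) = range (profinite_embedding B)"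
      using * by blast
    then show ?b using profinite_iso_induced_map[OF AC CD ann] by blast
  qed
  moreover have "?c" if ?b
    using that lattice_module_iso[OF assms(2) ann] by (metis Int_absorb)
  moreover have "?a" if ?c
    using that lattice_intersection_free_conjugate[OF assms(1,2,4) ann]
    unfolding profinite_iso_def by blast
  ultimately show ?thesis by blast
qed

end
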